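(* Let $G$ be a finite transitive permutation group on $\Omega$ and let $H_G$ be the subgroup generated by all elements of $G$ fixing at least one point of $\Omega$. (1) If $H_G=\{1\}$, then $\Gamma_G$ is a complete graph and $G$ acts regularly; in particular $G$ has the EKR-property and $\rho(G)=1$. (2) If $H_G$ is a proper subgroup of $G$, then $\Gamma_G$ is a join of $[G:H_G]$ copies of $\Gamma_{H_G}$; further $\alpha(\Gamma_G)=\alpha(\Gamma_{H_G})$ and $\rho(G)=\rho(H_G)$. (3) If $H_G=G$, then $\Gamma_G$ is not a join.
   Context: For a permutation group $K$ on $\Omega$, the derangement graph $\Gamma_K$ has vertex set $K$, with $g,h$ adjacent iff $gh^{-1}$ is a derangement (fixed-point-free). $\alpha$ denotes independence number. A subset $\mathcal{F}\subseteq K$ is intersecting if for all $g,h\in\mathcal{F}$ some $\omega\in\Omega$ has $\omega^g=\omega^h$; with $K_\omega$ a point stabilizer of maximum size, $\rho(K)=\max\{|\mathcal{F}|/|K_\omega|:\mathcal{F}\text{ intersecting}\}$. A transitive group has the EKR-property if the maximum size of an intersecting family is $|K|/|\Omega|$. A graph is a join of graphs if its vertex set can be partitioned into parts with every vertex of one part adjacent to every vertex of every other part. *)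

theory Defs
  imports
    Complex_Main
    "HOL-Algebra.Group_Action"
    "HOL-Algebra.Generated_Groups"
    "HOL-Library.Disjoint_Sets"
    "Graph_Theory.Graph_Theory"
begin

section \<open>Permutation groups\<close>

text \<open>
  A permutation group on \<open>\<Omega>\<close> is a subgroup \<open>K\<close> of the symmetric group \<^term>\<open>BijGroup \<Omega>\<close>,
  acting on \<open>\<Omega>\<close> by evaluation. Permutations act on the left, that is, \<open>g \<omega>\<close> stands for the
  exponential notation \<open>\<omega>^g\<close>. With either convention, \<open>g h^-1\<close> fixes a point if and only if
  \<open>g\<close> and \<open>h\<close> agree at some point.
\<close>

abbreviation perm_group :: "'a set \<Rightarrow> ('a \<Rightarrow> 'a) set \<Rightarrow> ('a \<Rightarrow> 'a) monoid" where
  "perm_group \<Omega> K \<equiv> (BijGroup \<Omega>)\<lparr>carrier := K\<rparr>"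

definition transitive_perm_group :: "'a set \<Rightarrow> ('a \<Rightarrow> 'a) set \<Rightarrow> bool" where
  "transitive_perm_group \<Omega> K \<longleftrightarrow>
     subgroup K (BijGroup \<Omega>) \<and> transitive_action (perm_group \<Omega> K) \<Omega> (\<lambda>g. g)"

abbreviation point_stabilizer :: "'a set \<Rightarrow> ('a \<Rightarrow> 'a) set \<Rightarrow> 'a \<Rightarrow> ('a \<Rightarrow> 'a) set" where
  "point_stabilizer \<Omega> K \<omega> \<equiv> stabilizer (perm_group \<Omega> K) (\<lambda>g. g) \<omega>"

definition regular_perm_group :: "'a set \<Rightarrow> ('a \<Rightarrow> 'a) set \<Rightarrow> bool" where
  "regular_perm_group \<Omega> K \<longleftrightarrow>
     transitive_perm_group \<Omega> K \<and>
     (\<forall>\<omega>\<in>\<Omega>. point_stabilizer \<Omega> K \<omega> = {\<one>\<^bsub>BijGroup \<Omega>\<^esub>})"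

definition derangement :: "'a set \<Rightarrow> ('a \<Rightarrow> 'a) \<Rightarrow> bool" where
  "derangement \<Omega> g \<longleftrightarrow> (\<forall>\<omega>\<in>\<Omega>. g \<omega> \<noteq> \<omega>)"

definition fixing_subgroup :: "'a set \<Rightarrow> ('a \<Rightarrow> 'a) set \<Rightarrow> ('a \<Rightarrow> 'a) set" where
  "fixing_subgroup \<Omega> K = generate (BijGroup \<Omega>) {g \<in> K. \<exists>\<omega>\<in>\<Omega>. g \<omega> = \<omega>}"


section \<open>Intersecting families\<close>

definition intersecting :: "'a set \<Rightarrow> ('a \<Rightarrow> 'a) set \<Rightarrow> ('a \<Rightarrow> 'a) set \<Rightarrow> bool" where
  "intersecting \<Omega> K F \<longleftrightarrow> F \<subseteq> K \<and> (\<forall>g\<in>F. \<forall>h\<in>F. \<exists>\<omega>\<in>\<Omega>. g \<omega> = h \<omega>)"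

definition max_stabilizer_size :: "'a set \<Rightarrow> ('a \<Rightarrow> 'a) set \<Rightarrow> nat" where
  "max_stabilizer_size \<Omega> K = Max {card (point_stabilizer \<Omega> K \<omega>) | \<omega>. \<omega> \<in> \<Omega>}"

definition intersection_density :: "'a set \<Rightarrow> ('a \<Rightarrow> 'a) set \<Rightarrow> real" where
  "intersection_density \<Omega> K =
     Max {real (card F) / real (max_stabilizer_size \<Omega> K) | F. intersecting \<Omega> K F}"

definition EKR_property :: "'a set \<Rightarrow> ('a \<Rightarrow> 'a) set \<Rightarrow> bool" where
  "EKR_property \<Omega> K \<longleftrightarrow>
     transitive_perm_group \<Omega> K \<and>
     real (Max {card F | F. intersecting \<Omega> K F}) = real (card K) / real (card \<Omega>)"


section \<open>Graphs\<close>

text \<open>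
  Simple graphs are symmetric loop-free digraphs; arcs are ordered pairs of vertices.
\<close>

definition derangement_graph ::
  "'a set \<Rightarrow> ('a \<Rightarrow> 'a) set \<Rightarrow> ('a \<Rightarrow> 'a, ('a \<Rightarrow> 'a) \<times> ('a \<Rightarrow> 'a)) pre_digraph" where
  "derangement_graph \<Omega> K = with_proj
     \<lparr>pverts = K,
      parcs = {(g, h). g \<in> K \<and> h \<in> K \<and>
        derangement \<Omega> (g \<otimes>\<^bsub>BijGroup \<Omega>\<^esub> inv\<^bsub>BijGroup \<Omega>\<^esub> h)}\<rparr>"

definition independent_set :: "('v, 'e) pre_digraph \<Rightarrow> 'v set \<Rightarrow> bool" where
  "independent_set \<Gamma> S \<longleftrightarrow> S \<subseteq> verts \<Gamma> \<and> (\<forall>u\<in>S. \<forall>v\<in>S. \<not> u \<rightarrow>\<^bsub>\<Gamma>\<^esub> v)"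

definition independence_number :: "('v, 'e) pre_digraph \<Rightarrow> nat" where
  "independence_number \<Gamma> = Max {card S | S. independent_set \<Gamma> S}"

definition join_partition :: "('v, 'e) pre_digraph \<Rightarrow> 'v set set \<Rightarrow> bool" where
  "join_partition \<Gamma> P \<longleftrightarrow>
     partition_on (verts \<Gamma>) P \<and>
     (\<forall>A\<in>P. \<forall>B\<in>P. A \<noteq> B \<longrightarrow> (\<forall>u\<in>A. \<forall>v\<in>B. u \<rightarrow>\<^bsub>\<Gamma>\<^esub> v))"

text \<open>
  Being a join requires at least two parts, since the partition into a single part satisfies the
  adjacency condition for every graph. Parts are nonempty by \<^const>\<open>partition_on\<close>.
\<close>

definition is_join :: "('v, 'e) pre_digraph \<Rightarrow> bool" where
  "is_join \<Gamma> \<longleftrightarrow> (\<exists>P. join_partition \<Gamma> P \<and> (\<exists>A\<in>P. \<exists>B\<in>P. A \<noteq> B))"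

definition is_join_of_copies ::
  "nat \<Rightarrow> ('v, 'e) pre_digraph \<Rightarrow> ('w, 'f) pre_digraph \<Rightarrow> bool" where
  "is_join_of_copies n \<Delta> \<Gamma> \<longleftrightarrow>
     (\<exists>P. join_partition \<Gamma> P \<and> card P = n \<and> (\<forall>A\<in>P. digraph_iso \<Delta> (\<Gamma> \<restriction> A)))"

end

theory Submission
  imports Defs
begin

text \<open>
  Two elements of \<open>G\<close> are non-adjacent exactly when they agree at a point, and then they lie in
  the same right coset of \<open>H\<close>, the subgroup generated by the elements with a fixed point. So distinct
  right cosets are completely joined, right translation identifies each of them with \<open>H\<close>, and an
  intersecting family translates into \<open>H\<close>. Conversely, a part of a join is closed under left
  multiplication by elements with a fixed point, hence under \<open>H\<close>, so it is everything if \<open>H = G\<close>.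
\<close>

section \<open>Adjacency in derangement graphs\<close>

lemma BijGroup_mult_apply:
  assumes "g \<in> carrier (BijGroup \<Omega>)" "h \<in> carrier (BijGroup \<Omega>)" "\<omega> \<in> \<Omega>"
  shows "(g \<otimes>\<^bsub>BijGroup \<Omega>\<^esub> h) \<omega> = g (h \<omega>)"
  using assms by (simp add: BijGroup_def compose_eq)

lemma BijGroup_image: "g \<in> carrier (BijGroup \<Omega>) \<Longrightarrow> g ` \<Omega> = \<Omega>"
  by (simp add: BijGroup_def Bij_def bij_betw_def)

text \<open>Right multiplication by \<open>k\<close> only relabels points: agreement of the products
  at \<omega> is agreement of \<open>g\<close> and \<open>h\<close> at \<open>k \<omega>\<close>,
  and \<open>k\<close> maps \<Omega> onto itself.\<close>

lemma BijGroup_agree_mult_right: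
  assumes "g \<in> carrier (BijGroup \<Omega>)" "h \<in> carrier (BijGroup \<Omega>)" "k \<in> carrier (BijGroup \<Omega>)"
  shows "(\<exists>\<omega>\<in>\<Omega>. (g \<otimes>\<^bsub>BijGroup \<Omega>\<^esub> k) \<omega> = (h \<otimes>\<^bsub>BijGroup \<Omega>\<^esub> k) \<omega>) \<longleftrightarrow> (\<exists>\<omega>\<in>\<Omega>. g \<omega> = h \<omega>)"
proof -
  have "(\<exists>\<omega>\<in>\<Omega>. (g \<otimes>\<^bsub>BijGroup \<Omega>\<^esub> k) \<omega> = (h \<otimes>\<^bsub>BijGroup \<Omega>\<^esub> k) \<omega>) \<longleftrightarrow> (\<exists>\<omega>\<in>\<Omega>. g (k \<omega>) = h (k \<omega>))"
    using assms by (simp add: BijGroup_mult_apply cong: bex_cong)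
  also have "\<dots> \<longleftrightarrow> (\<exists>\<omega>\<in>k ` \<Omega>. g \<omega> = h \<omega>)"
    by blast
  finally show ?thesis
    by (simp only: BijGroup_image[OF assms(3)])
qed

text \<open>Right translation by the inverse of \<open>h\<close> turns agreement of \<open>g\<close>
  with \<open>h\<close> into agreement of the quotient with the identity, that is, into a fixed
  point.\<close>

lemma derangement_mult_inv_iff:
  assumes "g \<in> carrier (BijGroup \<Omega>)" "h \<in> carrier (BijGroup \<Omega>)"
  shows "derangement \<Omega> (g \<otimes>\<^bsub>BijGroup \<Omega>\<^esub> inv\<^bsub>BijGroup \<Omega>\<^esub> h) \<longleftrightarrow> (\<forall>\<omega>\<in>\<Omega>. g \<omega> \<noteq> h \<omega>)"
proof -
  interpret group "BijGroup \<Omega>" by (rule group_BijGroup)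
  have "(\<exists>\<omega>\<in>\<Omega>. (g \<otimes>\<^bsub>BijGroup \<Omega>\<^esub> inv\<^bsub>BijGroup \<Omega>\<^esub> h) \<omega> = (h \<otimes>\<^bsub>BijGroup \<Omega>\<^esub> inv\<^bsub>BijGroup \<Omega>\<^esub> h) \<omega>)
      \<longleftrightarrow> (\<exists>\<omega>\<in>\<Omega>. g \<omega> = h \<omega>)"
    using assms by (intro BijGroup_agree_mult_right) auto
  \<comment> \<open>The product must collapse to the group identity before
    \<open>BijGroup_def\<close> is unfolded; that identity is the identity map restricted to
    \<Omega>.\<close>
  moreover have "(h \<otimes>\<^bsub>BijGroup \<Omega>\<^esub> inv\<^bsub>BijGroup \<Omega>\<^esub> h) \<omega> = \<omega>" if "\<omega> \<in> \<Omega>" for \<omega>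
    using assms(2) that by (simp, simp add: BijGroup_def)
  ultimately show ?thesis
    by (auto simp: derangement_def)
qed

text \<open>Removes the group operations from adjacency, so that later arguments only compare values
  of permutations.\<close>

lemma derangement_graph_conv:
  assumes "K \<subseteq> carrier (BijGroup \<Omega>)"
  shows "derangement_graph \<Omega> K =
    with_proj \<lparr>pverts = K, parcs = {(g, h). g \<in> K \<and> h \<in> K \<and> (\<forall>\<omega>\<in>\<Omega>. g \<omega> \<noteq> h \<omega>)}\<rparr>"
proof -
  have "{(g, h). g \<in> K \<and> h \<in> K \<and> derangement \<Omega> (g \<otimes>\<^bsub>BijGroup \<Omega>\<^esub> inv\<^bsub>BijGroup \<Omega>\<^esub> h)} =
    {(g, h). g \<in> K \<and> h \<in> K \<and> (\<forall>\<omega>\<in>\<Omega>. g \<omega> \<noteq> h \<omega>)}"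
    using assms derangement_mult_inv_iff by blast
  then show ?thesis
    by (simp add: derangement_graph_def)
qed

text \<open>Non-adjacency is agreement at some point. Both definitions also compare an element with
  itself, so they match even for empty \<Omega>.\<close>

lemma independent_set_derangement_graph_iff:
  assumes "K \<subseteq> carrier (BijGroup \<Omega>)"
  shows "independent_set (derangement_graph \<Omega> K) S \<longleftrightarrow> intersecting \<Omega> K S"
  using assms by (simp add: derangement_graph_conv independent_set_def intersecting_def) blast

lemma digraph_iso_derangement_graph_rcoset:
  assumes "subgroup H (BijGroup \<Omega>)" "subgroup G (BijGroup \<Omega>)" "H \<subseteq> G" "g \<in> G"
  shows "digraph_iso (derangement_graph \<Omega> H) (derangement_graph \<Omega> G \<restriction> (H #>\<^bsub>BijGroup \<Omega>\<^esub> g))"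
proof -
  interpret group "BijGroup \<Omega>" by (rule group_BijGroup)
  let ?r = "\<lambda>u. u \<otimes>\<^bsub>BijGroup \<Omega>\<^esub> g"
  \<comment> \<open>Arcs are pairs of vertices, so the arc map is translation in both components,
    with the projections as tail and head.\<close>
  let ?f = "\<lparr>iso_verts = ?r, iso_arcs = map_prod ?r ?r, iso_head = snd, iso_tail = fst\<rparr>"
  have carr: "H \<subseteq> carrier (BijGroup \<Omega>)" "G \<subseteq> carrier (BijGroup \<Omega>)"
    using assms subgroup.subset by blast+
  have g: "g \<in> carrier (BijGroup \<Omega>)"
    using carr assms by blast
  have inj: "inj_on ?r H"
    using carr g by (meson inj_onI right_cancel subsetD)
  have coset: "H #>\<^bsub>BijGroup \<Omega>\<^esub> g = ?r ` H"
    by (auto simp: r_coset_def)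
  have coset_G: "?r ` H \<subseteq> G"
    using assms by (auto intro: subgroup.m_closed)
  have agree: "(\<forall>\<omega>\<in>\<Omega>. ?r u \<omega> \<noteq> ?r v \<omega>) \<longleftrightarrow> (\<forall>\<omega>\<in>\<Omega>. u \<omega> \<noteq> v \<omega>)" if "u \<in> H" "v \<in> H" for u v
    using BijGroup_agree_mult_right[of u \<Omega> v g] that carr g by blast
  let ?AH = "{(u, v). u \<in> H \<and> v \<in> H \<and> (\<forall>\<omega>\<in>\<Omega>. u \<omega> \<noteq> v \<omega>)}"
  let ?AG = "{(u, v). u \<in> G \<and> v \<in> G \<and> (\<forall>\<omega>\<in>\<Omega>. u \<omega> \<noteq> v \<omega>)}"
  have "inj_on (map_prod ?r ?r) ?AH"
    by (rule inj_on_subset[OF map_prod_inj_on[OF inj inj]]) auto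
  then have "pre_digraph.digraph_isomorphism (derangement_graph \<Omega> H) ?f"
    using inj carr by (auto simp: pre_digraph.digraph_isomorphism_def derangement_graph_conv wf_digraph_def)
  \<comment> \<open>The arcs induced on the coset are exactly the translated arcs of
    \<open>H\<close>, because \<open>agree\<close> works in both directions.\<close>
  moreover have "{e \<in> ?AG. fst e \<in> ?r ` H \<and> snd e \<in> ?r ` H} = map_prod ?r ?r ` ?AH"
  proof (intro equalityI subsetI)
    fix e assume "e \<in> {e \<in> ?AG. fst e \<in> ?r ` H \<and> snd e \<in> ?r ` H}"
    then obtain u v where "u \<in> H" "v \<in> H" "e = (?r u, ?r v)" "\<forall>\<omega>\<in>\<Omega>. ?r u \<omega> \<noteq> ?r v \<omega>"
      by (cases e) auto
    then show "e \<in> map_prod ?r ?r ` ?AH"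
      using agree by (intro image_eqI[of _ _ "(u, v)"]) auto
  next
    fix e assume "e \<in> map_prod ?r ?r ` ?AH"
    then show "e \<in> {e \<in> ?AG. fst e \<in> ?r ` H \<and> snd e \<in> ?r ` H}"
      using agree coset_G by auto
  qed
  then have "derangement_graph \<Omega> G \<restriction> (H #>\<^bsub>BijGroup \<Omega>\<^esub> g) = app_iso ?f (derangement_graph \<Omega> H)"
    using carr by (simp add: derangement_graph_conv coset app_iso_def induce_subgraph_def)
  ultimately show ?thesis
    unfolding digraph_iso_def by blast
qed


section \<open>The subgroup generated by the elements with a fixed point\<close>

lemma fixing_subgroup_is_subgroup:
  assumes "subgroup G (BijGroup \<Omega>)"
  shows "subgroup (fixing_subgroup \<Omega> G) (BijGroup \<Omega>)"
  unfolding fixing_subgroup_def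
  using assms subgroup.subset by (intro group.generate_is_subgroup[OF group_BijGroup]) blast

lemma fixing_subgroup_subset:
  assumes "subgroup G (BijGroup \<Omega>)"
  shows "fixing_subgroup \<Omega> G \<subseteq> G"
  unfolding fixing_subgroup_def
  using assms by (intro group.generate_subgroup_incl[OF group_BijGroup]) auto

lemma fixing_subgroup_incl: "g \<in> G \<Longrightarrow> \<omega> \<in> \<Omega> \<Longrightarrow> g \<omega> = \<omega> \<Longrightarrow> g \<in> fixing_subgroup \<Omega> G"
  unfolding fixing_subgroup_def by (auto intro: generate.incl)

text \<open>The quotient is not a derangement, hence is one of the generators. Thus non-adjacent
  elements share a right coset.\<close>

lemma agree_imp_mult_inv_in_fixing_subgroup:
  assumes "subgroup G (BijGroup \<Omega>)" "g \<in> G" "h \<in> G" "\<omega> \<in> \<Omega>" "g \<omega> = h \<omega>"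
  shows "g \<otimes>\<^bsub>BijGroup \<Omega>\<^esub> inv\<^bsub>BijGroup \<Omega>\<^esub> h \<in> fixing_subgroup \<Omega> G"
proof -
  have "\<not> derangement \<Omega> (g \<otimes>\<^bsub>BijGroup \<Omega>\<^esub> inv\<^bsub>BijGroup \<Omega>\<^esub> h)"
    using assms derangement_mult_inv_iff[of g \<Omega> h] subgroup.subset by blast
  then show ?thesis
    using assms(1-3) subgroup.m_closed subgroup.m_inv_closed
    by (fastforce simp: derangement_def intro: fixing_subgroup_incl)
qed

section \<open>Stabilizers and intersecting families in the fixing subgroup\<close>

text \<open>Every element of \<open>G\<close> that fixes \<omega> is itself a generator, so no
  stabilizer shrinks. This keeps the denominator of the intersection density.\<close>

lemma point_stabilizer_fixing_subgroup:
  assumes "subgroup G (BijGroup \<Omega>)" "\<omega> \<in> \<Omega>"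
  shows "point_stabilizer \<Omega> (fixing_subgroup \<Omega> G) \<omega> = point_stabilizer \<Omega> G \<omega>"
  using fixing_subgroup_subset[OF assms(1)] assms(2)
  by (auto simp: stabilizer_def intro: fixing_subgroup_incl)

lemma max_stabilizer_size_fixing_subgroup:
  assumes "subgroup G (BijGroup \<Omega>)"
  shows "max_stabilizer_size \<Omega> (fixing_subgroup \<Omega> G) = max_stabilizer_size \<Omega> G"
  by (simp add: max_stabilizer_size_def Setcompr_eq_image point_stabilizer_fixing_subgroup[OF assms]
      cong: image_cong_simp)

text \<open>Dividing on the right by a member \<open>f\<close> moves the family into the subgroup,
  since every member agrees with \<open>f\<close> somewhere; translation is injective and preserves
  agreement.\<close>

lemma intersecting_translate_fixing_subgroup:
  assumes "subgroup G (BijGroup \<Omega>)" "intersecting \<Omega> G F"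
  obtains F' where "intersecting \<Omega> (fixing_subgroup \<Omega> G) F'" "card F' = card F"
proof (cases "F = {}")
  case True
  then show ?thesis
    using that[of "{}"] by (simp add: intersecting_def)
next
  case False
  then obtain f where f: "f \<in> F" by blast
  interpret group "BijGroup \<Omega>" by (rule group_BijGroup)
  let ?r = "\<lambda>u. u \<otimes>\<^bsub>BijGroup \<Omega>\<^esub> inv\<^bsub>BijGroup \<Omega>\<^esub> f"
  have F: "F \<subseteq> G" "\<And>g h. g \<in> F \<Longrightarrow> h \<in> F \<Longrightarrow> \<exists>\<omega>\<in>\<Omega>. g \<omega> = h \<omega>"
    using assms(2) by (auto simp: intersecting_def)
  have carr: "F \<subseteq> carrier (BijGroup \<Omega>)"
    using F(1) assms(1) subgroup.subset by blast
  have "?r ` F \<subseteq> fixing_subgroup \<Omega> G"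
    using agree_imp_mult_inv_in_fixing_subgroup[OF assms(1)] F f by blast
  moreover have "\<exists>\<omega>\<in>\<Omega>. ?r g \<omega> = ?r h \<omega>" if "g \<in> F" "h \<in> F" for g h
    using BijGroup_agree_mult_right[of g \<Omega> h "inv\<^bsub>BijGroup \<Omega>\<^esub> f"] F(2)[OF that] carr f that by auto
  ultimately have "intersecting \<Omega> (fixing_subgroup \<Omega> G) (?r ` F)"
    by (auto simp: intersecting_def)
  moreover have "inj_on ?r F"
    using carr f by (meson inj_onI inv_closed right_cancel subsetD)
  ultimately show ?thesis
    using that card_image by blast
qed

text \<open>Equating the whole sets of sizes, not just their maxima, lets \<open>Max\<close> be
  rewritten directly in the next two results.\<close>

lemma card_intersecting_fixing_subgroup:
  assumes "subgroup G (BijGroup \<Omega>)"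
  shows "{card F |F. intersecting \<Omega> (fixing_subgroup \<Omega> G) F} = {card F |F. intersecting \<Omega> G F}"
proof (intro equalityI subsetI)
  fix n assume "n \<in> {card F |F. intersecting \<Omega> (fixing_subgroup \<Omega> G) F}"
  then show "n \<in> {card F |F. intersecting \<Omega> G F}"
    using fixing_subgroup_subset[OF assms] by (auto simp: intersecting_def)
next
  fix n assume "n \<in> {card F |F. intersecting \<Omega> G F}"
  then show "n \<in> {card F |F. intersecting \<Omega> (fixing_subgroup \<Omega> G) F}"
    using intersecting_translate_fixing_subgroup[OF assms] by (smt (verit) mem_Collect_eq)
qed

lemma independence_number_fixing_subgroup:
  assumes "subgroup G (BijGroup \<Omega>)"
  shows "independence_number (derangement_graph \<Omega> (fixing_subgroup \<Omega> G)) =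
    independence_number (derangement_graph \<Omega> G)"
  using card_intersecting_fixing_subgroup[OF assms] subgroup.subset[OF assms]
    subgroup.subset[OF fixing_subgroup_is_subgroup[OF assms]]
  by (simp add: independence_number_def independent_set_derangement_graph_iff)

lemma intersection_density_fixing_subgroup:
  assumes "subgroup G (BijGroup \<Omega>)"
  shows "intersection_density \<Omega> (fixing_subgroup \<Omega> G) = intersection_density \<Omega> G"
proof -
  \<comment> \<open>The density sees a family only through its size, so the set of ratios is an
    image of the set of sizes.\<close>
  have image: "{real (card F) / c |F. intersecting \<Omega> K F} =
    (\<lambda>n. real n / c) ` {card F |F. intersecting \<Omega> K F}" for K c
    by blast
  show ?thesis
    unfolding intersection_density_def image
    by (simp only: card_intersecting_fixing_subgroup[OF assms]
        max_stabilizer_size_fixing_subgroup[OF assms])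
qed

section \<open>Join decompositions of the derangement graph\<close>

lemma join_partition_rcosets_fixing_subgroup:
  assumes "subgroup G (BijGroup \<Omega>)"
  shows "join_partition (derangement_graph \<Omega> G) (rcosets\<^bsub>perm_group \<Omega> G\<^esub> (fixing_subgroup \<Omega> G))"
proof -
  let ?H = "fixing_subgroup \<Omega> G"
  interpret B: group "BijGroup \<Omega>" by (rule group_BijGroup)
  interpret P: group "perm_group \<Omega> G" by (rule B.subgroup_imp_group[OF assms])
  have H: "subgroup ?H (perm_group \<Omega> G)"
    using B.subgroup_incl[OF fixing_subgroup_is_subgroup assms fixing_subgroup_subset] assms by blast
  have "\<Union>(rcosets\<^bsub>perm_group \<Omega> G\<^esub> ?H) = G"
    using P.rcosets_part_G[OF H] by simp
  moreover have "{} \<notin> rcosets\<^bsub>perm_group \<Omega> G\<^esub> ?H"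
    using subgroup.rcosets_non_empty[OF H] by blast
  moreover have "u \<rightarrow>\<^bsub>derangement_graph \<Omega> G\<^esub> v"
    if AB: "A \<in> rcosets\<^bsub>perm_group \<Omega> G\<^esub> ?H" "B \<in> rcosets\<^bsub>perm_group \<Omega> G\<^esub> ?H" "A \<noteq> B"
      and uv: "u \<in> A" "v \<in> B" for A B u v
  proof -
    have G: "u \<in> G" "v \<in> G"
      using AB uv P.rcosets_part_G[OF H] by auto
    have "u \<omega> \<noteq> v \<omega>" if "\<omega> \<in> \<Omega>" for \<omega>
    proof
      assume "u \<omega> = v \<omega>"
      \<comment> \<open>Cosets are formed in \<open>perm_group \<Omega> G\<close>, whose product and
        inverse agree on \<open>G\<close> with those of \<open>BijGroup \<Omega>\<close>.\<close>
      then have "u \<otimes>\<^bsub>perm_group \<Omega> G\<^esub> inv\<^bsub>perm_group \<Omega> G\<^esub> v \<in> ?H"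
        using agree_imp_mult_inv_in_fixing_subgroup[OF assms G that] assms G by simp
      then have "u \<in> ?H #>\<^bsub>perm_group \<Omega> G\<^esub> v"
        using subgroup.rcos_module[OF H P.is_group] G by simp
      \<comment> \<open>The coset of \<open>v\<close> meets \<open>A\<close> in \<open>u\<close> and
        \<open>B\<close> in \<open>v\<close>; disjointness of cosets then forces
        \<open>A = B\<close>.\<close>
      moreover have "v \<in> ?H #>\<^bsub>perm_group \<Omega> G\<^esub> v" "?H #>\<^bsub>perm_group \<Omega> G\<^esub> v \<in> rcosets\<^bsub>perm_group \<Omega> G\<^esub> ?H"
        using P.rcos_self[OF _ H] P.rcosetsI subgroup.subset[OF H] G by auto
      ultimately show False
        using P.rcos_disjoint[OF H] AB uv unfolding pairwise_def disjnt_iff by metis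
    qed
    then show ?thesis
      using G subgroup.subset[OF assms] by (simp add: derangement_graph_conv)
  qed
  ultimately show ?thesis
    using P.rcos_disjoint[OF H]
    by (simp add: join_partition_def partition_on_def derangement_graph_def)
qed

lemma is_join_of_copies_fixing_subgroup:
  assumes "subgroup G (BijGroup \<Omega>)"
  shows "is_join_of_copies (card (rcosets\<^bsub>perm_group \<Omega> G\<^esub> (fixing_subgroup \<Omega> G)))
    (derangement_graph \<Omega> (fixing_subgroup \<Omega> G)) (derangement_graph \<Omega> G)"
proof -
  have "digraph_iso (derangement_graph \<Omega> (fixing_subgroup \<Omega> G)) (derangement_graph \<Omega> G \<restriction> A)"
    if "A \<in> rcosets\<^bsub>perm_group \<Omega> G\<^esub> (fixing_subgroup \<Omega> G)" for A
    using that digraph_iso_derangement_graph_rcoset[OF fixing_subgroup_is_subgroup assms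
        fixing_subgroup_subset] assms
    by (auto simp: RCOSETS_def)
  then show ?thesis
    using join_partition_rcosets_fixing_subgroup[OF assms] unfolding is_join_of_copies_def by blast
qed

text \<open>If \<open>s\<close> fixes a point, then \<open>s \<otimes> u\<close> agrees with
  \<open>u\<close> somewhere and cannot lie in another part. Induction over the generated subgroup
  extends this from generators to all of it.\<close>

lemma join_partition_part_closed:
  assumes G: "subgroup G (BijGroup \<Omega>)"
    and P: "join_partition (derangement_graph \<Omega> G) P" "A \<in> P"
    and h: "h \<in> fixing_subgroup \<Omega> G" and g: "g \<in> A"
  shows "h \<otimes>\<^bsub>BijGroup \<Omega>\<^esub> g \<in> A"
proof -
  interpret group "BijGroup \<Omega>" by (rule group_BijGroup)
  have carr: "G \<subseteq> carrier (BijGroup \<Omega>)"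
    using G by (rule subgroup.subset)
  have UP: "\<Union>P = G"
    using P(1) by (simp add: join_partition_def partition_on_def derangement_graph_def)
  have same: "v \<in> A" if uv: "u \<in> A" "v \<in> G" "\<exists>\<omega>\<in>\<Omega>. u \<omega> = v \<omega>" for u v
  proof (rule ccontr)
    assume "v \<notin> A"
    then obtain B where "B \<in> P" "v \<in> B" "A \<noteq> B"
      using uv UP by blast
    then have "u \<rightarrow>\<^bsub>derangement_graph \<Omega> G\<^esub> v"
      using P uv unfolding join_partition_def by blast
    then show False
      using uv(3) carr by (auto simp: derangement_graph_conv)
  qed
  have step: "s \<otimes>\<^bsub>BijGroup \<Omega>\<^esub> u \<in> A" if "s \<in> G" "\<omega> \<in> \<Omega>" "s \<omega> = \<omega>" "u \<in> A" for s \<omega> u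
  proof -
    have u: "u \<in> G" using that UP P by blast
    \<comment> \<open>Surjectivity of \<open>u\<close> supplies a preimage \<alpha> of the fixed
      point of \<open>s\<close>; there \<open>s \<otimes> u\<close> and \<open>u\<close>
      agree.\<close>
    have "\<omega> \<in> u ` \<Omega>"
      using BijGroup_image u carr \<open>\<omega> \<in> \<Omega>\<close> by blast
    then obtain \<alpha> where "\<alpha> \<in> \<Omega>" "u \<alpha> = \<omega>"
      by blast
    then have "(s \<otimes>\<^bsub>BijGroup \<Omega>\<^esub> u) \<alpha> = u \<alpha>"
      using BijGroup_mult_apply[of s \<Omega> u \<alpha>] carr u that by auto
    then show ?thesis
      using same[OF that(4), of "s \<otimes>\<^bsub>BijGroup \<Omega>\<^esub> u"] subgroup.m_closed[OF G that(1) u] \<open>\<alpha> \<in> \<Omega>\<close>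
      by metis
  qed
  \<comment> \<open>Needed for the \<open>inv\<close> case below: the inverse of a generator fixes
    the same point, so \<open>step\<close> applies to it too.\<close>
  have inv_fix: "(inv\<^bsub>BijGroup \<Omega>\<^esub> s) \<omega> = \<omega>" if "s \<in> G" "\<omega> \<in> \<Omega>" "s \<omega> = \<omega>" for s \<omega>
  proof -
    have s: "s \<in> Bij \<Omega>"
      using that(1) carr by (auto simp: BijGroup_def)
    then have "inj_on s \<Omega>"
      by (simp add: Bij_def bij_betw_def)
    then show ?thesis
      using that inv_into_f_f[of s \<Omega> \<omega>] by (simp add: inv_BijGroup[OF s])
  qed
  have AG: "A \<subseteq> carrier (BijGroup \<Omega>)"
    using UP P carr by blast
  have sub: "{s \<in> G. \<exists>\<omega>\<in>\<Omega>. s \<omega> = \<omega>} \<subseteq> carrier (BijGroup \<Omega>)"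
    using carr by blast
  from h show ?thesis
    unfolding fixing_subgroup_def using g
  \<comment> \<open>The element \<open>g\<close> is generalized because the \<open>eng\<close> case
    applies the hypothesis for \<open>s\<close> to \<open>t \<otimes> g\<close>.\<close>
  proof (induction arbitrary: g rule: generate.induct)
    case one
    then show ?case using AG by auto
  next
    case (incl s)
    then show ?case using step by blast
  next
    case (inv s)
    then show ?case
      using step[of "inv\<^bsub>BijGroup \<Omega>\<^esub> s"] inv_fix subgroup.m_inv_closed[OF G] by blast
  next
    case (eng s t)
    then have "s \<in> carrier (BijGroup \<Omega>)" "t \<in> carrier (BijGroup \<Omega>)"
      using generate_in_carrier[OF sub] by blast+
    moreover have "s \<otimes>\<^bsub>BijGroup \<Omega>\<^esub> (t \<otimes>\<^bsub>BijGroup \<Omega>\<^esub> g) \<in> A"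
      by (intro eng.IH eng.prems)
    ultimately show ?case
      using eng.prems AG m_assoc[of s t g] by auto
  qed
qed

text \<open>For \<open>a\<close> and \<open>b\<close> in different parts, the quotient of
  \<open>b\<close> by \<open>a\<close> lies in \<open>G\<close>, the fixing subgroup, and carries
  \<open>a\<close> to \<open>b\<close>; closure of parts puts \<open>b\<close> in the part of
  \<open>a\<close>.\<close>

lemma not_is_join_derangement_graph:
  assumes G: "subgroup G (BijGroup \<Omega>)" and gen: "fixing_subgroup \<Omega> G = G"
  shows "\<not> is_join (derangement_graph \<Omega> G)"
proof
  assume "is_join (derangement_graph \<Omega> G)"
  then obtain P A B where P: "join_partition (derangement_graph \<Omega> G) P"
    and AB: "A \<in> P" "B \<in> P" "A \<noteq> B"
    unfolding is_join_def by blast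
  interpret group "BijGroup \<Omega>" by (rule group_BijGroup)
  have part: "\<Union>P = G" "disjoint P" "{} \<notin> P"
    using P by (simp_all add: join_partition_def partition_on_def derangement_graph_def)
  have "A \<noteq> {}" "B \<noteq> {}"
    using AB part(3) by auto
  then obtain a b where ab: "a \<in> A" "b \<in> B" by blast
  then have abG: "a \<in> G" "b \<in> G"
    using AB part by blast+
  then have carr: "a \<in> carrier (BijGroup \<Omega>)" "b \<in> carrier (BijGroup \<Omega>)"
    using subgroup.subset[OF G] by blast+
  have "b \<otimes>\<^bsub>BijGroup \<Omega>\<^esub> inv\<^bsub>BijGroup \<Omega>\<^esub> a \<in> fixing_subgroup \<Omega> G"
    unfolding gen using abG subgroup.m_closed[OF G] subgroup.m_inv_closed[OF G] by blast
  then have "(b \<otimes>\<^bsub>BijGroup \<Omega>\<^esub> inv\<^bsub>BijGroup \<Omega>\<^esub> a) \<otimes>\<^bsub>BijGroup \<Omega>\<^esub> a \<in> A"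
    using join_partition_part_closed[OF G P AB(1) _ ab(1)] by blast
  then have "b \<in> A"
    using carr by (simp add: m_assoc)
  then show False
    using part(2) AB ab unfolding disjoint_def by blast
qed


section \<open>Trivial fixing subgroup\<close>

lemma trivial_fixing_subgroup_agree_imp_eq:
  assumes "subgroup G (BijGroup \<Omega>)" "fixing_subgroup \<Omega> G = {\<one>\<^bsub>BijGroup \<Omega>\<^esub>}"
    and "g \<in> G" "h \<in> G" "\<omega> \<in> \<Omega>" "g \<omega> = h \<omega>"
  shows "g = h"
proof -
  interpret group "BijGroup \<Omega>" by (rule group_BijGroup)
  have "g \<in> carrier (BijGroup \<Omega>)" "h \<in> carrier (BijGroup \<Omega>)"
    using assms subgroup.subset by blast+
  then show ?thesis
    using agree_imp_mult_inv_in_fixing_subgroup[OF assms(1,3-6)] assms(2) inv_equality inv_solve_right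
    by (metis inv_closed l_one singletonD one_closed)
qed

lemma trivial_fixing_subgroup_complete:
  assumes "\<Omega> \<noteq> {}" "finite G" "subgroup G (BijGroup \<Omega>)" "fixing_subgroup \<Omega> G = {\<one>\<^bsub>BijGroup \<Omega>\<^esub>}"
  shows "complete_digraph (card G) (derangement_graph \<Omega> G)"
proof -
  \<comment> \<open>A point of \<Omega> rules out loops, as each element agrees with itself there;
    distinct elements agree nowhere.\<close>
  have "{(g, h). g \<in> G \<and> h \<in> G \<and> (\<forall>\<omega>\<in>\<Omega>. g \<omega> \<noteq> h \<omega>)} = {(g, h). (g, h) \<in> G \<times> G \<and> g \<noteq> h}"
    using trivial_fixing_subgroup_agree_imp_eq[OF assms(3,4)] assms(1) by blast
  then show ?thesis
    using assms(2) subgroup.subset[OF assms(3)]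
    by (simp add: derangement_graph_conv complete_digraph_pair_def)
qed

lemma trivial_fixing_subgroup_stabilizer:
  assumes "subgroup G (BijGroup \<Omega>)" "fixing_subgroup \<Omega> G = {\<one>\<^bsub>BijGroup \<Omega>\<^esub>}" "\<omega> \<in> \<Omega>"
  shows "point_stabilizer \<Omega> G \<omega> = {\<one>\<^bsub>BijGroup \<Omega>\<^esub>}"
proof -
  have "\<one>\<^bsub>BijGroup \<Omega>\<^esub> \<omega> = \<omega>"
    using assms(3) by (simp add: BijGroup_def)
  moreover have "g = \<one>\<^bsub>BijGroup \<Omega>\<^esub>" if "g \<in> G" "g \<omega> = \<omega>" for g
    using fixing_subgroup_incl[OF that(1) assms(3) that(2)] assms(2) by blast
  ultimately have "{g \<in> G. g \<omega> = \<omega>} = {\<one>\<^bsub>BijGroup \<Omega>\<^esub>}"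
    using subgroup.one_closed[OF assms(1)] by blast
  then show ?thesis
    by (simp add: stabilizer_def)
qed

text \<open>Agreement at one point forces equality, so an intersecting family has at most one
  member. The empty family and the identity alone attain the two sizes.\<close>

lemma trivial_fixing_subgroup_card_intersecting:
  assumes "\<Omega> \<noteq> {}" "subgroup G (BijGroup \<Omega>)" "fixing_subgroup \<Omega> G = {\<one>\<^bsub>BijGroup \<Omega>\<^esub>}"
  shows "{card F |F. intersecting \<Omega> G F} = {0, 1}"
proof (intro equalityI subsetI)
  fix n assume "n \<in> {card F |F. intersecting \<Omega> G F}"
  then obtain F where F: "intersecting \<Omega> G F" "n = card F" by blast
  then have "x = y" if "x \<in> F" "y \<in> F" for x y
    using that trivial_fixing_subgroup_agree_imp_eq[OF assms(2,3)] unfolding intersecting_def by blast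
  then have "F = {} \<or> (\<exists>x. F = {x})"
    by blast
  then show "n \<in> {0, 1}"
    using F(2) by auto
next
  fix n :: nat assume "n \<in> {0, 1}"
  moreover have "intersecting \<Omega> G {}" "intersecting \<Omega> G {\<one>\<^bsub>BijGroup \<Omega>\<^esub>}"
    using assms(1) subgroup.one_closed[OF assms(2)] by (auto simp: intersecting_def)
  ultimately show "n \<in> {card F |F. intersecting \<Omega> G F}"
    by (force intro: exI[of _ "{}"] exI[of _ "{\<one>\<^bsub>BijGroup \<Omega>\<^esub>}"])
qed

text \<open>Orbit-stabilizer, with transitivity making the orbit of \<omega> all of
  \<Omega>.\<close>

lemma transitive_card_eq:
  assumes "transitive_perm_group \<Omega> G" "\<omega> \<in> \<Omega>"
  shows "card \<Omega> * card (point_stabilizer \<Omega> G \<omega>) = card G"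
proof -
  interpret transitive_action "perm_group \<Omega> G" \<Omega> "\<lambda>g. g"
    using assms(1) by (simp add: transitive_perm_group_def)
  have "Group_Action.orbit (perm_group \<Omega> G) (\<lambda>g. g) \<omega> = \<Omega>"
    using unique_orbit[OF assms(2)] element_image[OF _ assms(2)] unfolding Group_Action.orbit_def by blast
  then show ?thesis
    using orbit_stabilizer_theorem[OF assms(2)] by (simp add: order_def)
qed

lemma trivial_fixing_subgroup_regular_EKR:
  assumes "\<Omega> \<noteq> {}" "finite G" "transitive_perm_group \<Omega> G"
    and triv: "fixing_subgroup \<Omega> G = {\<one>\<^bsub>BijGroup \<Omega>\<^esub>}"
  shows "regular_perm_group \<Omega> G" "EKR_property \<Omega> G" "intersection_density \<Omega> G = 1"
proof -
  have G: "subgroup G (BijGroup \<Omega>)"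
    using assms(3) by (simp add: transitive_perm_group_def)
  note stab = trivial_fixing_subgroup_stabilizer[OF G triv]
  note cards = trivial_fixing_subgroup_card_intersecting[OF assms(1) G triv]
  obtain \<omega> where \<omega>: "\<omega> \<in> \<Omega>" using assms(1) by blast
  show "regular_perm_group \<Omega> G"
    using assms(3) stab by (simp add: regular_perm_group_def)
  have "card \<Omega> = card G"
    using transitive_card_eq[OF assms(3) \<omega>] stab[OF \<omega>] by simp
  \<comment> \<open>Positivity makes the ratio of the two equal cardinalities 1, the maximum of the
    sizes 0 and 1, rather than the default value 0 of division by zero.\<close>
  moreover have "card G > 0"
    using assms(2) subgroup.one_closed[OF G] by (auto simp: card_gt_0_iff)
  ultimately show "EKR_property \<Omega> G"
    using assms(3) by (simp add: EKR_property_def cards)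
  have "{card (point_stabilizer \<Omega> G \<omega>) |\<omega>. \<omega> \<in> \<Omega>} = {1}"
    using stab \<omega> by (auto simp: Setcompr_eq_image cong: image_cong_simp)
  then have "max_stabilizer_size \<Omega> G = 1"
    by (simp add: max_stabilizer_size_def)
  moreover have "{real (card F) |F. intersecting \<Omega> G F} = real ` {card F |F. intersecting \<Omega> G F}"
    by blast
  ultimately show "intersection_density \<Omega> G = 1"
    by (simp add: intersection_density_def cards)
qed

theorem theorem2p10:
  fixes \<Omega> :: "'a set" and G H :: "('a \<Rightarrow> 'a) set"
  assumes "\<Omega> \<noteq> {}"
    and "finite G"
    and "transitive_perm_group \<Omega> G"
    and "H = fixing_subgroup \<Omega> G"
  shows "(H = {\<one>\<^bsub>BijGroup \<Omega>\<^esub>} \<longrightarrow>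
            complete_digraph (card G) (derangement_graph \<Omega> G) \<and>
            regular_perm_group \<Omega> G \<and>
            EKR_property \<Omega> G \<and>
            intersection_density \<Omega> G = 1)
       \<and> (H \<subset> G \<longrightarrow>
            is_join_of_copies (card (rcosets\<^bsub>perm_group \<Omega> G\<^esub> H))
              (derangement_graph \<Omega> H) (derangement_graph \<Omega> G) \<and>
            independence_number (derangement_graph \<Omega> G) =
              independence_number (derangement_graph \<Omega> H) \<and>
            intersection_density \<Omega> G = intersection_density \<Omega> H)
       \<and> (H = G \<longrightarrow> \<not> is_join (derangement_graph \<Omega> G))"
proof -
  have G: "subgroup G (BijGroup \<Omega>)"
    using assms(3) by (simp add: transitive_perm_group_def)
  show ?thesis
    unfolding assms(4)
    using trivial_fixing_subgroup_complete[OF assms(1,2) G]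
      trivial_fixing_subgroup_regular_EKR[OF assms(1-3)]
      is_join_of_copies_fixing_subgroup[OF G] independence_number_fixing_subgroup[OF G]
      intersection_density_fixing_subgroup[OF G] not_is_join_derangement_graph[OF G]
    by (auto simp del: One_nat_def)
qed

end
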